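(* Let $X$ be a Cantor space. If $K, K_0$ are conjugacy invariant subsets of $C_s(X)$ and $K$ is closed, then $K_0 \subset K$ if and only if $\Gamma(K_0) \subset \Gamma(K)$. In particular, for $f \in C_s(X)$ the closure in $C_s(X)$ of the conjugacy class of $f$ is $\{ g \in C_s(X) : \Gamma(g) \subset \Gamma(f) \}$.
   Context: A Cantor space is a nonempty, compact, zero-dimensional, perfect metric space. $C_s(X)$ is the space of continuous surjections $X\to X$ with the sup metric; the homeomorphism group $H(X)$ acts on $C_s(X)$ by $f \mapsto h\circ f\circ h^{-1}$; orbits are called conjugacy classes, and a subset is conjugacy invariant if it is invariant under this action. $\mathbb{N}$ is the set of positive integers; $\mathcal{I}$ is the set of all nonempty finite subsets of $\mathbb{N}^n$, $n=1,2,\dots$ (discrete topology). A surjective relation on $I$ is a subset $\phi\subset I\times I$ both of whose coordinate projections are onto $I$. A partition is a continuous surjection $\alpha: X\to I$ with $I\in\mathcal{I}$, and $f^\alpha=\{(\alpha(x),\alpha(f(x))):x\in X\}$. For $f\in C_s(X)$, $\Gamma(f)$ is the set of surjective relations $\phi$ on elements of $\mathcal{I}$ such that $\phi=f^\alpha$ for some partition $\alpha$; for $K\subset C_s(X)$, $\Gamma(K)=\bigcup_{f\in K}\Gamma(f)$. *)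

theory Defs
  imports "HOL-Analysis.Analysis"
begin

definition zero_dimensional :: "'a topology \<Rightarrow> bool" where
  "zero_dimensional T \<longleftrightarrow>
     (\<forall>U x. openin T U \<and> x \<in> U \<longrightarrow> (\<exists>V. openin T V \<and> closedin T V \<and> x \<in> V \<and> V \<subseteq> U))"

definition cantor_space :: "'a::metric_space set \<Rightarrow> bool" where
  "cantor_space S \<longleftrightarrow>
     S \<noteq> {} \<and> compact S \<and> zero_dimensional (top_of_set S) \<and> (\<forall>x\<in>S. x islimpt S)"

text \<open>The space \<open>X\<close> is the carrier of a metric type \<open>'a\<close>. When it is compact,
  every continuous self-map is bounded, so that the type \<open>'a \<Rightarrow>\<^sub>C 'a\<close> consists of all
  continuous self-maps of \<open>X\<close>, and its metric is the sup metric.\<close>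

definition Cs :: "('a::metric_space \<Rightarrow>\<^sub>C 'a) set" where
  "Cs = {f. surj (apply_bcontfun f)}"

definition homeos :: "('a::metric_space \<Rightarrow> 'a) set" where
  "homeos = {h. \<exists>k. homeomorphism UNIV UNIV h k}"

text \<open>Meaningful for a compact space, where the conjugated map is again bounded.\<close>

definition conjugate :: "('a::metric_space \<Rightarrow> 'a) \<Rightarrow> ('a \<Rightarrow>\<^sub>C 'a) \<Rightarrow> ('a \<Rightarrow>\<^sub>C 'a)" where
  "conjugate h f = Bcontfun (h \<circ> apply_bcontfun f \<circ> inv h)"

lemma apply_conjugate:
  assumes "compact (UNIV :: 'a::metric_space set)" "h \<in> homeos"
  shows "apply_bcontfun (conjugate h (f :: 'a \<Rightarrow>\<^sub>C 'a)) = h \<circ> apply_bcontfun f \<circ> inv h"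
proof -
  obtain k where k: "homeomorphism UNIV UNIV h k"
    using assms(2) by (auto simp: homeos_def)
  have "inv h = k"
    using k by (intro inv_equality) (auto simp: homeomorphism_def)
  then have "continuous_on UNIV h" "continuous_on UNIV (inv h)"
    using k by (auto simp: homeomorphism_def)
  then have "continuous_on UNIV (h \<circ> apply_bcontfun f \<circ> inv h)"
    by (meson continuous_on_apply_bcontfun continuous_on_compose continuous_on_subset subset_UNIV)
  moreover have "bounded (range (h \<circ> apply_bcontfun f \<circ> inv h))"
    using compact_imp_bounded[OF assms(1)] bounded_subset by blast
  ultimately show ?thesis
    by (simp add: conjugate_def Bcontfun_inverse bcontfun_def)
qed

definition conj_class :: "('a::metric_space \<Rightarrow>\<^sub>C 'a) \<Rightarrow> ('a \<Rightarrow>\<^sub>C 'a) set" where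
  "conj_class f = {conjugate h f | h. h \<in> homeos}"

definition conj_invariant :: "('a::metric_space \<Rightarrow>\<^sub>C 'a) set \<Rightarrow> bool" where
  "conj_invariant K \<longleftrightarrow> (\<forall>h\<in>homeos. \<forall>f\<in>K. conjugate h f \<in> K)"

text \<open>Elements of the power \<open>N^n\<close> are lists of length \<open>n\<close> with positive entries; all elements
  of an index set have the same length.\<close>

definition index_sets :: "nat list set set" where
  "index_sets =
     {I. finite I \<and> I \<noteq> {} \<and> (\<exists>n\<ge>1. \<forall>v\<in>I. length v = n \<and> (\<forall>i\<in>set v. 0 < i))}"

definition surjective_relation :: "'i set \<Rightarrow> ('i \<times> 'i) set \<Rightarrow> bool" where
  "surjective_relation I \<phi> \<longleftrightarrow> \<phi> \<subseteq> I \<times> I \<and> fst ` \<phi> = I \<and> snd ` \<phi> = I"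

definition is_partition :: "nat list set \<Rightarrow> ('a::metric_space \<Rightarrow> nat list) \<Rightarrow> bool" where
  "is_partition I \<alpha> \<longleftrightarrow>
     I \<in> index_sets \<and> continuous_map euclidean (discrete_topology I) \<alpha> \<and> range \<alpha> = I"

definition relation_of :: "('a::metric_space \<Rightarrow>\<^sub>C 'a) \<Rightarrow> ('a \<Rightarrow> 'i) \<Rightarrow> ('i \<times> 'i) set" where
  "relation_of f \<alpha> = {(\<alpha> x, \<alpha> (apply_bcontfun f x)) | x. True}"

text \<open>The partition may be taken onto the same index set \<open>I\<close>, since
  \<open>relation_of f \<alpha>\<close> has first projection \<open>range \<alpha>\<close>.\<close>

definition Gamma_fun :: "('a::metric_space \<Rightarrow>\<^sub>C 'a) \<Rightarrow> (nat list \<times> nat list) set set" where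
  "Gamma_fun f = {\<phi>. \<exists>I\<in>index_sets. surjective_relation I \<phi> \<and>
                  (\<exists>\<alpha>. is_partition I \<alpha> \<and> \<phi> = relation_of f \<alpha>)}"

definition Gamma_set :: "('a::metric_space \<Rightarrow>\<^sub>C 'a) set \<Rightarrow> (nat list \<times> nat list) set set" where
  "Gamma_set K = (\<Union>f\<in>K. Gamma_fun f)"

end

theory Submission
  imports Defs
begin

text \<open>
  The relation \<open>relation_of f \<alpha>\<close> records \<open>f\<close> up to the resolution of the finite partition \<open>\<alpha>\<close>,
  and \<open>Gamma_fun f\<close> collects these records with the position of the partition in the space
  forgotten. The theorem says that forgetting the position amounts exactly to passing to the
  closure of the conjugacy class.

  That \<open>Gamma_fun\<close> sees no more than this closure is the easy half. Conjugating \<open>f\<close> by \<open>h\<close> just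
  replaces \<open>\<alpha>\<close> by \<open>\<alpha> \<circ> h\<close>, so \<open>Gamma_fun\<close> does not grow along a conjugacy class. By compactness a
  partition \<open>\<alpha>\<close> has a Lebesgue number, and two maps closer than that number have the same
  relation, so \<open>Gamma_fun\<close> does not grow under limits either (\<open>Gamma_fun_limit\<close>).

  For the converse let \<open>Gamma_fun g \<subseteq> Gamma_set K\<close>, and choose a partition \<open>\<alpha>\<close> into cells of small
  diameter. The relation of \<open>g\<close> under \<open>\<alpha>\<close> is also the relation of some \<open>f\<close> in \<open>K\<close> under a
  partition \<open>\<beta>\<close>. Hence the partitions \<open>x \<mapsto> (\<alpha> x, \<alpha> (g x))\<close> and \<open>y \<mapsto> (\<beta> y, \<beta> (f y))\<close> have the same
  set of labels. Suppose that a homeomorphism \<open>h\<close> carries each cell of the second onto the cell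
  of the first with the same label. Then \<open>\<alpha> (h (f y)) = \<beta> (f y) = \<alpha> (g (h y))\<close>, so
  \<open>h \<circ> f \<circ> h\<^sup>-\<^sup>1\<close> and \<open>g\<close> send every point into a common cell of \<open>\<alpha>\<close>: a conjugate of \<open>f\<close> is
  uniformly close to \<open>g\<close> (\<open>conjugate_close\<close>, \<open>approximate_by_conjugates\<close>).

  The homeomorphism is where the Cantor space enters (\<open>homeomorphism_matching\<close>). Any two nonempty
  clopen sets of a Cantor space are homeomorphic, and the proof here treats all cells at once by a
  back-and-forth construction. A cell on one side is cut into small pieces, and the cell with the
  same label on the other side is cut into equally many nonempty pieces, which is possible because
  the space is perfect (\<open>split_open\<close>). Cutting alternately on both sides gives two sequences of
  ever finer partitions with equal label sets, and points with the same labels at every stage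
  correspond under \<open>h\<close>.
\<close>

section \<open>Locally constant labellings\<close>

text \<open>A partition is treated as a map that is constant near each point, so that labels may come
  from any type without a topology on it, and finitely many partitions can be refined to a common
  one by pairing their labels.\<close>

definition locally_constant :: "('a::topological_space \<Rightarrow> 'i) \<Rightarrow> bool" where
  "locally_constant f \<longleftrightarrow> (\<forall>x. \<forall>\<^sub>F y in nhds x. f y = f x)"

lemma locally_constant_compose: "locally_constant f \<Longrightarrow> locally_constant (\<lambda>x. p (f x))"
  unfolding locally_constant_def by (rule allI, drule spec, erule eventually_mono, simp)

lemma locally_constant_combine:
  assumes "locally_constant f" "locally_constant g"
  shows "locally_constant (\<lambda>x. p (f x) (g x))"
  unfolding locally_constant_def
proof
  fix x
  have "\<forall>\<^sub>F y in nhds x. f y = f x" "\<forall>\<^sub>F y in nhds x. g y = g x"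
    using assms by (auto simp: locally_constant_def)
  then show "\<forall>\<^sub>F y in nhds x. p (f y) (g y) = p (f x) (g x)"
    by eventually_elim simp
qed

lemma locally_constant_clopen:
  assumes "open V" "closed V"
  shows "locally_constant (\<lambda>x. x \<in> V)"
  unfolding locally_constant_def
proof
  fix x
  show "\<forall>\<^sub>F y in nhds x. (y \<in> V) = (x \<in> V)"
  proof (cases "x \<in> V")
    case True
    then show ?thesis using eventually_nhds_in_open[OF assms(1)] by simp
  next
    case False
    then show ?thesis using eventually_nhds_in_open[of "- V" x] assms(2) by (simp add: open_Compl)
  qed
qed

lemma open_locally_constant_vimage:
  assumes "locally_constant f"
  shows "open {x. P (f x)}"
proof (rule topological_space_class.openI)
  fix x assume "x \<in> {x. P (f x)}"
  then have "P (f x)" by simp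
  have "\<forall>\<^sub>F y in nhds x. f y = f x"
    using assms by (simp add: locally_constant_def)
  then obtain U where "open U" "x \<in> U" and U: "\<forall>y\<in>U. f y = f x"
    unfolding eventually_nhds by blast
  moreover have "U \<subseteq> {x. P (f x)}" using U \<open>P (f x)\<close> by auto
  ultimately show "\<exists>T. open T \<and> x \<in> T \<and> T \<subseteq> {x. P (f x)}" by blast
qed

lemma closed_locally_constant_vimage:
  assumes "locally_constant f"
  shows "closed {x. P (f x)}"
  using open_locally_constant_vimage[OF assms, of "\<lambda>i. \<not> P i"]
  by (simp add: closed_def Collect_neg_eq)

lemma locally_constant_continuous_compose:
  assumes "locally_constant f" "continuous_on UNIV h"
  shows "locally_constant (\<lambda>x. f (h x))"
  unfolding locally_constant_def
proof
  fix x
  have "open (h -` {y. f y = f (h x)})"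
    using assms(2) open_locally_constant_vimage[OF assms(1), of "\<lambda>i. i = f (h x)"]
    by (intro open_vimage)
  from eventually_nhds_in_open[OF this, of x]
  show "\<forall>\<^sub>F y in nhds x. f (h y) = f (h x)" by simp
qed

text \<open>The number \<open>e\<close> is a Lebesgue number of the open cover by the fibres of \<open>f\<close>.\<close>

lemma locally_constant_uniform:
  fixes f :: "'a::metric_space \<Rightarrow> 'i"
  assumes "compact (UNIV :: 'a set)" "locally_constant f"
  obtains e where "e > 0" "\<And>x y. dist x y < e \<Longrightarrow> f x = f y"
proof -
  let ?G = "range (\<lambda>i. {x. f x = i})"
  have "open B" if "B \<in> ?G" for B
    using that open_locally_constant_vimage[OF assms(2)] by auto
  moreover have "UNIV \<subseteq> \<Union> ?G"
    by auto
  ultimately obtain e where "e > 0" and e: "\<And>x. x \<in> UNIV \<Longrightarrow> \<exists>B\<in>?G. ball x e \<subseteq> B"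
    by - (rule Heine_Borel_lemma[OF assms(1), of ?G], auto)
  have "f x = f y" if "dist x y < e" for x y
  proof -
    obtain i where "ball x e \<subseteq> {x. f x = i}" using e[of x] by auto
    moreover have "x \<in> ball x e" "y \<in> ball x e" using that \<open>e > 0\<close> by auto
    ultimately show ?thesis by blast
  qed
  with \<open>e > 0\<close> that show ?thesis by blast
qed

lemma finite_range_locally_constant:
  assumes "compact (UNIV :: 'a::topological_space set)" "locally_constant (f :: 'a \<Rightarrow> 'i)"
  shows "finite (range f)"
proof -
  have "\<And>i. i \<in> UNIV \<Longrightarrow> open {x. f x = i}"
    using open_locally_constant_vimage[OF assms(2)] by auto
  moreover have "UNIV \<subseteq> (\<Union>i. {x. f x = i})" by auto
  ultimately obtain I where "finite I" "UNIV \<subseteq> (\<Union>i\<in>I. {x. f x = i})"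
    by (rule compactE_image[OF assms(1)])
  then have "range f \<subseteq> I" by auto
  with \<open>finite I\<close> show ?thesis by (rule rev_finite_subset)
qed

lemma is_partition_imp_locally_constant:
  assumes "is_partition I \<alpha>"
  shows "locally_constant \<alpha>"
  unfolding locally_constant_def
proof
  fix x
  have "continuous_map euclidean (discrete_topology I) \<alpha>" "\<alpha> x \<in> I"
    using assms by (auto simp: is_partition_def)
  then have "openin euclidean {y \<in> topspace euclidean. \<alpha> y \<in> {\<alpha> x}}"
    by (intro openin_continuous_map_preimage) auto
  then have "open {y. \<alpha> y = \<alpha> x}" by simp
  from eventually_nhds_in_open[OF this, of x]
  show "\<forall>\<^sub>F y in nhds x. \<alpha> y = \<alpha> x" by simp
qed

lemma is_partitionI:
  assumes "range \<alpha> \<in> index_sets" "locally_constant \<alpha>"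
  shows "is_partition (range \<alpha>) \<alpha>"
proof -
  have "openin euclidean {x. \<alpha> x \<in> U}" for U
    using open_locally_constant_vimage[OF assms(2), of "\<lambda>i. i \<in> U"] by simp
  then show ?thesis
    using assms(1) by (auto simp: is_partition_def continuous_map_def)
qed

section \<open>Fine partitions and splittings of a Cantor space\<close>

lemma cantor_space_clopen:
  assumes "cantor_space (UNIV :: 'a::metric_space set)" "open U" "(x::'a) \<in> U"
  obtains V where "open V" "closed V" "x \<in> V" "V \<subseteq> U"
  using assms unfolding cantor_space_def zero_dimensional_def
  by (metis open_openin closed_closedin subtopology_UNIV)

lemma cantor_space_compact:
  "cantor_space (UNIV :: 'a::metric_space set) \<Longrightarrow> compact (UNIV :: 'a set)"
  by (simp add: cantor_space_def)

text \<open>Take a finite cover by small clopen sets and label a point by the members of the cover that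
  contain it. The label sets are finitely many, so they can be coded by natural numbers.\<close>

lemma fine_labelling:
  assumes "cantor_space (UNIV :: 'a::metric_space set)" "e > 0"
  obtains \<gamma> :: "'a::metric_space \<Rightarrow> nat"
  where "locally_constant \<gamma>" "\<And>x y. \<gamma> x = \<gamma> y \<Longrightarrow> dist x y < e"
proof -
  note cpt = cantor_space_compact[OF assms(1)]
  have "\<exists>V. open V \<and> closed V \<and> x \<in> V \<and> V \<subseteq> ball x (e/2)" for x :: 'a
    by (rule cantor_space_clopen[OF assms(1) open_ball, of x x "e/2"]) (use assms(2) in auto)
  then obtain V where V: "\<And>x::'a. open (V x)" "\<And>x. closed (V x)" "\<And>x. x \<in> V x"
      "\<And>x. V x \<subseteq> ball x (e/2)"
    by metis
  have "UNIV \<subseteq> (\<Union>x. V x)" using V(3) by blast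
  then obtain F where "finite F" and F: "UNIV \<subseteq> (\<Union>x\<in>F. V x)"
    by (rule compactE_image[OF cpt V(1)])
  define c where "c y = {x \<in> F. y \<in> V x}" for y
  have "locally_constant c"
    unfolding locally_constant_def
  proof
    fix y
    have "\<forall>x\<in>F. \<forall>\<^sub>F z in nhds y. (z \<in> V x) = (y \<in> V x)"
      using locally_constant_clopen[OF V(1,2)] by (auto simp: locally_constant_def)
    then have "\<forall>\<^sub>F z in nhds y. \<forall>x\<in>F. (z \<in> V x) = (y \<in> V x)"
      using \<open>finite F\<close> by (simp add: eventually_ball_finite)
    then show "\<forall>\<^sub>F z in nhds y. c z = c y"
      by eventually_elim (auto simp: c_def)
  qed
  have fine: "dist y z < e" if "c y = c z" for y z
  proof -
    obtain x where "x \<in> F" "y \<in> V x" using F by blast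
    then have "x \<in> c y" by (simp add: c_def)
    then have "x \<in> c z" using that by simp
    then have "z \<in> V x" by (simp add: c_def)
    then have "dist x y < e/2" "dist x z < e/2" using \<open>y \<in> V x\<close> V(4)[of x] by auto
    then show ?thesis by (rule dist_triangle_half_r)
  qed
  have "countable (range c)"
    using finite_range_locally_constant[OF cpt \<open>locally_constant c\<close>] by (rule countable_finite)
  then have "inj_on (to_nat_on (range c)) (range c)" by (rule inj_on_to_nat_on)
  then have "dist x y < e" if "to_nat_on (range c) (c x) = to_nat_on (range c) (c y)" for x y
    using that by (intro fine) (meson inj_onD rangeI)
  then show ?thesis
    by (rule that[OF locally_constant_compose[OF \<open>locally_constant c\<close>]])
qed

text \<open>This is the use of perfectness: a nonempty open set can be cut into as many nonempty clopen
  pieces as wanted, because every piece contains a second point and so can be cut once more.\<close>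

lemma split_open:
  assumes "cantor_space (UNIV :: 'a::metric_space set)"
    and "open B" "B \<noteq> {}" "finite S" "S \<noteq> {}"
  obtains \<delta> :: "'a::metric_space \<Rightarrow> 'i" where "locally_constant \<delta>" "\<delta> ` B = S"
proof -
  have "\<exists>\<delta> :: 'a \<Rightarrow> 'i. locally_constant \<delta> \<and> \<delta> ` B = S"
    using assms(4,5)
  proof (induction S rule: finite_ne_induct)
    case (singleton s)
    then show ?case
      using \<open>B \<noteq> {}\<close> by (intro exI[of _ "\<lambda>_. s"]) (auto simp: locally_constant_def)
  next
    case (insert s S)
    then obtain \<delta> :: "'a \<Rightarrow> 'i"
      where \<delta>: "locally_constant \<delta>" "\<delta> ` B = S" by auto
    obtain x where x: "x \<in> B" using \<open>B \<noteq> {}\<close> by blast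
    \<comment> \<open>The piece that contains \<open>x\<close> gives up a clopen part \<open>V\<close> to the new label \<open>s\<close> and keeps its
      own label, still attained at \<open>x\<close>.\<close>
    let ?C = "B \<inter> {y. \<delta> y = \<delta> x}"
    have "open ?C" using \<open>open B\<close> open_locally_constant_vimage[OF \<delta>(1)] by (intro open_Int)
    moreover have "x islimpt UNIV" using assms(1) by (simp add: cantor_space_def)
    ultimately obtain y where y: "y \<in> ?C" "y \<noteq> x"
      using x islimptE[of x UNIV ?C] by blast
    have "open (?C - {x})" "y \<in> ?C - {x}" using \<open>open ?C\<close> y by (auto intro: open_delete)
    then obtain V where V: "open V" "closed V" "y \<in> V" "V \<subseteq> ?C - {x}"
      by (rule cantor_space_clopen[OF assms(1)])
    let ?\<delta> = "\<lambda>z. if z \<in> V then s else \<delta> z"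
    have "locally_constant ?\<delta>"
      using locally_constant_combine[OF locally_constant_clopen[OF V(1,2)] \<delta>(1),
          of "\<lambda>b i. if b then s else i"] .
    moreover have "insert s S \<subseteq> ?\<delta> ` B"
    proof -
      have "s \<in> ?\<delta> ` B" using V y(1) by (intro image_eqI[of _ _ y]) auto
      moreover have "i \<in> ?\<delta> ` B" if "i \<in> S" for i
      proof -
        have "i \<in> \<delta> ` B" using that \<delta>(2) by simp
        then obtain z where z: "z \<in> B" "\<delta> z = i" by blast
        show ?thesis
        proof (cases "z \<in> V")
          case True
          then have "\<delta> x = i" "x \<notin> V" using V(4) z by auto
          then show ?thesis using x by (intro image_eqI[of _ _ x]) auto
        next
          case False
          then show ?thesis using z by (intro image_eqI[of _ _ z]) auto
        qed
      qed
      ultimately show ?thesis by blast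
    qed
    moreover have "?\<delta> ` B \<subseteq> insert s S" using \<delta>(2) by auto
    ultimately show ?case by (intro exI[of _ ?\<delta>]) blast
  qed
  with that show ?thesis by blast
qed

section \<open>Matching two partitions by a homeomorphism\<close>

text \<open>Half a step of the back-and-forth construction. The cells of \<open>\<alpha>\<close> are cut into small pieces,
  and each cell of \<open>\<beta>\<close> is cut to follow suit, with no control over the size of its pieces. A new
  label consists of the old label and the label of the piece.\<close>

lemma refine_pair_left:
  fixes \<alpha> \<beta> :: "'a::metric_space \<Rightarrow> nat"
  assumes X: "cantor_space (UNIV :: 'a set)" and "e > 0"
    and "locally_constant \<alpha>" "locally_constant \<beta>" "range \<alpha> = range \<beta>"
  obtains \<alpha>' \<beta>' :: "'a \<Rightarrow> nat"
  where "locally_constant \<alpha>'" "locally_constant \<beta>'" "range \<alpha>' = range \<beta>'"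
    "\<And>x y. \<alpha>' x = \<beta>' y \<Longrightarrow> \<alpha> x = \<beta> y"
    "\<And>x y. \<alpha>' x = \<alpha>' y \<Longrightarrow> dist x y < e"
proof -
  obtain \<gamma> :: "'a \<Rightarrow> nat"
    where \<gamma>: "locally_constant \<gamma>" "\<And>x y. \<gamma> x = \<gamma> y \<Longrightarrow> dist x y < e"
    using fine_labelling[OF X \<open>e > 0\<close>] by blast
  have fin: "finite (\<gamma> ` A)" for A
    using finite_range_locally_constant[OF cantor_space_compact[OF X] \<gamma>(1)]
    by (rule rev_finite_subset) auto
  let ?A = "\<lambda>i. {x. \<alpha> x = i}" and ?B = "\<lambda>i. {y. \<beta> y = i}"
  have "\<exists>\<delta>. locally_constant \<delta> \<and> \<delta> ` ?B i = \<gamma> ` ?A i" if "i \<in> range \<beta>" for i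
  proof -
    have "i \<in> range \<alpha>" using that assms(5) by simp
    then have "?B i \<noteq> {}" "\<gamma> ` ?A i \<noteq> {}" using that by auto
    then obtain \<delta> :: "'a \<Rightarrow> nat" where "locally_constant \<delta>" "\<delta> ` ?B i = \<gamma> ` ?A i"
      by (rule split_open[OF X open_locally_constant_vimage[OF assms(4), of "\<lambda>j. j = i"] _ fin[of "?A i"]])
    then show ?thesis by blast
  qed
  then obtain \<delta> where \<delta>: "\<And>i. i \<in> range \<beta> \<Longrightarrow> locally_constant (\<delta> i)"
      "\<And>i. i \<in> range \<beta> \<Longrightarrow> \<delta> i ` ?B i = \<gamma> ` ?A i"
    by metis
  define \<alpha>' where "\<alpha>' x = prod_encode (\<alpha> x, \<gamma> x)" for x
  define \<beta>' where "\<beta>' y = prod_encode (\<beta> y, \<delta> (\<beta> y) y)" for y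
  have "locally_constant \<alpha>'"
    unfolding \<alpha>'_def using locally_constant_combine[OF assms(3) \<gamma>(1)] .
  moreover have "locally_constant \<beta>'"
    unfolding locally_constant_def
  proof
    fix y
    have "\<forall>\<^sub>F z in nhds y. \<beta> z = \<beta> y" "\<forall>\<^sub>F z in nhds y. \<delta> (\<beta> y) z = \<delta> (\<beta> y) y"
      using assms(4) \<delta>(1)[of "\<beta> y"] by (auto simp: locally_constant_def)
    then show "\<forall>\<^sub>F z in nhds y. \<beta>' z = \<beta>' y"
      by eventually_elim (simp add: \<beta>'_def)
  qed
  moreover have "range \<alpha>' = range \<beta>'"
  proof (intro equalityI subsetI; elim rangeE; clarify)
    fix x
    have "\<alpha> x \<in> range \<beta>" using assms(5) by blast
    then have "\<gamma> x \<in> \<delta> (\<alpha> x) ` ?B (\<alpha> x)" using \<delta>(2) by auto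
    then obtain y where "\<beta> y = \<alpha> x" "\<delta> (\<alpha> x) y = \<gamma> x" by auto
    then have "\<alpha>' x = \<beta>' y" by (simp add: \<alpha>'_def \<beta>'_def)
    then show "\<alpha>' x \<in> range \<beta>'" by auto
  next
    fix y
    have "\<delta> (\<beta> y) y \<in> \<gamma> ` ?A (\<beta> y)" using \<delta>(2)[of "\<beta> y"] by auto
    then obtain x where "\<alpha> x = \<beta> y" "\<gamma> x = \<delta> (\<beta> y) y" by auto
    then have "\<beta>' y = \<alpha>' x" by (simp add: \<alpha>'_def \<beta>'_def)
    then show "\<beta>' y \<in> range \<alpha>'" by auto
  qed
  ultimately show ?thesis
    using \<gamma>(2) by (intro that[of \<alpha>' \<beta>']) (auto simp: \<alpha>'_def \<beta>'_def)
qed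

text \<open>The same half step with the two sides exchanged makes the pieces on the second side small.
  It preserves smallness on the first side: cells refer to each other through equal label sets,
  so the new labelling of the first side is finer than the old one.\<close>

lemma refine_pair:
  fixes \<alpha> \<beta> :: "'a::metric_space \<Rightarrow> nat"
  assumes X: "cantor_space (UNIV :: 'a set)" and "e > 0"
    and "locally_constant \<alpha>" "locally_constant \<beta>" "range \<alpha> = range \<beta>"
  obtains \<alpha>' \<beta>' :: "'a \<Rightarrow> nat"
  where "locally_constant \<alpha>'" "locally_constant \<beta>'" "range \<alpha>' = range \<beta>'"
    "\<And>x y. \<alpha>' x = \<beta>' y \<Longrightarrow> \<alpha> x = \<beta> y"
    "\<And>x y. \<alpha>' x = \<alpha>' y \<Longrightarrow> dist x y < e"
    "\<And>x y. \<beta>' x = \<beta>' y \<Longrightarrow> dist x y < e"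
proof -
  obtain \<alpha>1 \<beta>1 :: "'a \<Rightarrow> nat"
    where 1: "locally_constant \<alpha>1" "locally_constant \<beta>1" "range \<alpha>1 = range \<beta>1"
      "\<And>x y. \<alpha>1 x = \<beta>1 y \<Longrightarrow> \<alpha> x = \<beta> y"
      "\<And>x y. \<alpha>1 x = \<alpha>1 y \<Longrightarrow> dist x y < e"
    using refine_pair_left[OF assms] by metis
  obtain \<beta>2 \<alpha>2 :: "'a \<Rightarrow> nat"
    where 2: "locally_constant \<beta>2" "locally_constant \<alpha>2" "range \<beta>2 = range \<alpha>2"
      "\<And>x y. \<beta>2 x = \<alpha>2 y \<Longrightarrow> \<beta>1 x = \<alpha>1 y"
      "\<And>x y. \<beta>2 x = \<beta>2 y \<Longrightarrow> dist x y < e"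
    using refine_pair_left[OF X \<open>e > 0\<close> 1(2,1) 1(3)[symmetric]] by metis
  have "dist x y < e" if "\<alpha>2 x = \<alpha>2 y" for x y
  proof -
    obtain z where "\<beta>2 z = \<alpha>2 x" using 2(3) by (metis rangeE rangeI)
    then show ?thesis using 1(5) 2(4) that by metis
  qed
  then show ?thesis
    using 1 2 by (intro that[of \<alpha>2 \<beta>2]) metis+
qed

text \<open>By compactness the nested nonempty closed cells with the labels of \<open>x\<close> have a common point.\<close>

lemma matched_section_nonempty:
  fixes \<alpha> \<beta> :: "nat \<Rightarrow> 'a::metric_space \<Rightarrow> 'i"
  assumes "compact (UNIV :: 'a set)" "\<And>n. locally_constant (\<beta> n)"
    and "\<And>n. range (\<alpha> n) = range (\<beta> n)"
    and "\<And>n x y. \<alpha> (Suc n) x = \<beta> (Suc n) y \<Longrightarrow> \<alpha> n x = \<beta> n y"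
  shows "\<exists>y. \<forall>n. \<alpha> n x = \<beta> n y"
proof -
  let ?F = "\<lambda>n. {y. \<alpha> n x = \<beta> n y}"
  have anti: "?F n \<subseteq> ?F m" if "m \<le> n" for m n
  proof (rule lift_Suc_antimono_le[where f = ?F, OF _ that])
    show "?F (Suc k) \<subseteq> ?F k" for k
      by (rule Collect_mono) (rule impI, rule assms(4))
  qed
  have "UNIV \<inter> (\<Inter>n. ?F n) \<noteq> {}"
  proof (rule compact_imp_fip_image[OF assms(1)])
    show "closed (?F n)" for n
      using closed_locally_constant_vimage[OF assms(2)] by simp
  next
    fix N :: "nat set" assume "finite N"
    define M where "M = Max (insert 0 N)"
    have "\<alpha> M x \<in> range (\<beta> M)" unfolding assms(3)[symmetric] by (rule rangeI)
    then obtain y where "y \<in> ?F M" by blast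
    moreover have "n \<le> M" if "n \<in> N" for n
      using that \<open>finite N\<close> by (simp add: M_def)
    ultimately have "y \<in> ?F n" if "n \<in> N" for n
      using anti that by blast
    then show "UNIV \<inter> (\<Inter>n\<in>N. ?F n) \<noteq> {}" by blast
  qed
  then show ?thesis by blast
qed

text \<open>Points near \<open>x\<close> share the label of \<open>x\<close> at stage \<open>n + 1\<close>, so their images lie in one small cell.\<close>

lemma continuous_matching:
  fixes \<alpha> \<beta> :: "nat \<Rightarrow> 'a::metric_space \<Rightarrow> 'i"
  assumes "\<And>n. locally_constant (\<alpha> n)"
    and fine: "\<And>n x y. \<beta> (Suc n) x = \<beta> (Suc n) y \<Longrightarrow> dist x y < inverse (real (Suc n))"
    and h: "\<And>n x. \<alpha> n x = \<beta> n (h x)"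
  shows "continuous_on UNIV h"
proof -
  have "isCont h x" for x
    unfolding isCont_def tendsto_iff
  proof (intro allI impI)
    fix e :: real assume "e > 0"
    then obtain n where n: "inverse (real (Suc n)) < e" using reals_Archimedean by blast
    have "\<forall>\<^sub>F y in nhds x. \<alpha> (Suc n) y = \<alpha> (Suc n) x"
      using assms(1) by (auto simp: locally_constant_def)
    then have "\<forall>\<^sub>F y in nhds x. dist (h y) (h x) < e"
      by eventually_elim (metis fine h n order_less_trans)
    then show "\<forall>\<^sub>F y in at x. dist (h y) (h x) < e"
      by (simp add: eventually_at_filter eventually_mono)
  qed
  then show ?thesis by (simp add: continuous_at_imp_continuous_on)
qed

text \<open>Two clopen partitions of a Cantor space with the same labels differ by a homeomorphism of the
  space. With one label on each side for a nonempty clopen set and one for its complement, this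
  contains the fact that any two proper nonempty clopen subsets are homeomorphic.\<close>

lemma homeomorphism_matching:
  fixes \<alpha> \<beta> :: "'a::metric_space \<Rightarrow> 'i"
  assumes X: "cantor_space (UNIV :: 'a set)"
    and "locally_constant \<alpha>" "locally_constant \<beta>" "range \<alpha> = range \<beta>"
  obtains h k where "homeomorphism UNIV UNIV h k" "\<And>x. \<beta> (h x) = \<alpha> x"
proof -
  note cpt = cantor_space_compact[OF X]
  let ?c = "to_nat_on (range \<beta>)"
  have inj: "inj_on ?c (range \<beta>)"
    using finite_range_locally_constant[OF cpt assms(3)]
    by (intro inj_on_to_nat_on countable_finite)
  \<comment> \<open>The recursion needs labels of one fixed type that can encode refined labels again, hence the
    initial labels are coded by natural numbers; \<open>P\<close> is the invariant and \<open>Q\<close> the refinement.\<close>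
  define P where "P n p \<longleftrightarrow>
    locally_constant (fst p) \<and> locally_constant (snd p) \<and> range (fst p) = range (snd p) \<and>
    (n = 0 \<longrightarrow> p = (\<lambda>x. ?c (\<alpha> x), \<lambda>x. ?c (\<beta> x)))"
    for n :: nat and p :: "('a \<Rightarrow> nat) \<times> ('a \<Rightarrow> nat)"
  define Q where "Q n p q \<longleftrightarrow>
    (\<forall>x y. fst q x = snd q y \<longrightarrow> fst p x = snd p y) \<and>
    (\<forall>x y. fst q x = fst q y \<longrightarrow> dist x y < inverse (real (Suc n))) \<and>
    (\<forall>x y. snd q x = snd q y \<longrightarrow> dist x y < inverse (real (Suc n)))"
    for n :: nat and p q :: "('a \<Rightarrow> nat) \<times> ('a \<Rightarrow> nat)"
  have "\<exists>s. \<forall>n. P n (s n) \<and> Q n (s n) (s (Suc n))"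
  proof (rule dependent_nat_choice)
    have "range (\<lambda>x. ?c (\<alpha> x)) = range (\<lambda>x. ?c (\<beta> x))"
      using assms(4) by (metis image_image)
    then show "\<exists>p. P 0 p"
      using locally_constant_compose[OF assms(2), of ?c] locally_constant_compose[OF assms(3), of ?c]
      by (simp add: P_def)
  next
    fix p n assume "P n p"
    then have p: "locally_constant (fst p)" "locally_constant (snd p)" "range (fst p) = range (snd p)"
      by (auto simp: P_def)
    have pos: "inverse (real (Suc n)) > 0" by simp
    obtain \<alpha>' \<beta>' :: "'a \<Rightarrow> nat"
      where "locally_constant \<alpha>'" "locally_constant \<beta>'" "range \<alpha>' = range \<beta>'"
        "\<And>x y. \<alpha>' x = \<beta>' y \<Longrightarrow> fst p x = snd p y"
        "\<And>x y. \<alpha>' x = \<alpha>' y \<Longrightarrow> dist x y < inverse (real (Suc n))"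
        "\<And>x y. \<beta>' x = \<beta>' y \<Longrightarrow> dist x y < inverse (real (Suc n))"
      using refine_pair[OF X pos p] by blast
    then show "\<exists>q. P (Suc n) q \<and> Q n p q"
      by (intro exI[of _ "(\<alpha>', \<beta>')"]) (simp add: P_def Q_def)
  qed
  then obtain s where s: "\<And>n. P n (s n)" "\<And>n. Q n (s n) (s (Suc n))" by blast
  define A where "A n = fst (s n)" for n
  define B where "B n = snd (s n)" for n
  have lc: "locally_constant (A n)" "locally_constant (B n)" and rg: "range (A n) = range (B n)" for n
    using s(1)[of n] unfolding P_def A_def B_def by blast+
  have step: "\<And>x y. A (Suc n) x = B (Suc n) y \<Longrightarrow> A n x = B n y"
    and fineA: "\<And>x y. A (Suc n) x = A (Suc n) y \<Longrightarrow> dist x y < inverse (real (Suc n))"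
    and fineB: "\<And>x y. B (Suc n) x = B (Suc n) y \<Longrightarrow> dist x y < inverse (real (Suc n))" for n
    using s(2)[of n] unfolding Q_def A_def B_def by blast+
  have zero: "A 0 = (\<lambda>x. ?c (\<alpha> x))" "B 0 = (\<lambda>x. ?c (\<beta> x))"
    using s(1)[of 0] unfolding P_def A_def B_def by simp_all
  have "\<exists>y. \<forall>n. A n x = B n y" for x
    using cpt lc(2) rg step by (rule matched_section_nonempty)
  then obtain h where h: "\<And>x n. A n x = B n (h x)" by metis
  have "\<exists>x. \<forall>n. B n y = A n x" for y
    using cpt lc(1) rg[symmetric] step[OF sym, symmetric] by (rule matched_section_nonempty)
  then obtain k where k: "\<And>y n. B n y = A n (k y)" by metis
  have sep: "x = y" if "\<And>n. dist x y < inverse (real (Suc n))" for x y :: 'a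
  proof (rule ccontr)
    assume "x \<noteq> y"
    then obtain n where "inverse (real (Suc n)) < dist x y"
      using reals_Archimedean[of "dist x y"] by auto
    with that[of n] show False by simp
  qed
  have "k (h x) = x" for x
    by (rule sep[OF fineA]) (rule trans[OF k[symmetric] h[symmetric]])
  moreover have "h (k y) = y" for y
    by (rule sep[OF fineB]) (rule trans[OF h[symmetric] k[symmetric]])
  moreover have "continuous_on UNIV h"
    using lc(1) fineB h by (rule continuous_matching)
  moreover have "continuous_on UNIV k"
    using lc(2) fineA k by (rule continuous_matching)
  ultimately have "homeomorphism UNIV UNIV h k"
    by (intro homeomorphismI) simp_all
  moreover have "\<beta> (h x) = \<alpha> x" for x
  proof (rule inj_onD[OF inj])
    show "?c (\<beta> (h x)) = ?c (\<alpha> x)" using h[where n = 0 and x = x] zero by simp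
    show "\<alpha> x \<in> range \<beta>" unfolding assms(4)[symmetric] by (rule rangeI)
  qed simp
  ultimately show ?thesis using that by blast
qed

section \<open>Conjugation and finite relations\<close>

lemma homeos_imp_continuous: "h \<in> homeos \<Longrightarrow> continuous_on UNIV h"
  by (auto simp: homeos_def homeomorphism_def)

lemma homeos_imp_bij:
  assumes "h \<in> homeos"
  shows "bij h"
proof -
  obtain k where "homeomorphism UNIV UNIV h k"
    using assms by (auto simp: homeos_def)
  then have "k (h x) = x" "h (k x) = x" for x by (auto simp: homeomorphism_def)
  then show ?thesis by (metis bijI')
qed

lemma conjugate_in_Cs:
  assumes "compact (UNIV :: 'a::metric_space set)" "h \<in> homeos" "(f :: 'a \<Rightarrow>\<^sub>C 'a) \<in> Cs"
  shows "conjugate h f \<in> Cs"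
proof -
  have "bij h" using assms(2) by (rule homeos_imp_bij)
  then have "surj h" "surj (inv h)" by (auto simp: bij_is_surj bij_imp_bij_inv)
  then show ?thesis
    using assms(3) unfolding Cs_def mem_Collect_eq apply_conjugate[OF assms(1,2)]
    by (intro comp_surj)
qed

lemma conj_class_subset_Cs:
  assumes "compact (UNIV :: 'a::metric_space set)" "(f :: 'a \<Rightarrow>\<^sub>C 'a) \<in> Cs"
  shows "conj_class f \<subseteq> Cs"
  using conjugate_in_Cs[OF assms(1) _ assms(2)] by (auto simp: conj_class_def)

lemma relation_of_eq_range: "relation_of f \<alpha> = range (\<lambda>x. (\<alpha> x, \<alpha> (apply_bcontfun f x)))"
  by (auto simp: relation_of_def)

text \<open>Conjugating the map is the same as moving the partition.\<close>

lemma relation_of_conjugate: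
  assumes "compact (UNIV :: 'a::metric_space set)" "h \<in> homeos"
  shows "relation_of (conjugate h (f :: 'a \<Rightarrow>\<^sub>C 'a)) \<alpha> = relation_of f (\<alpha> \<circ> h)"
proof -
  have "bij h" using assms(2) by (rule homeos_imp_bij)
  then have h: "range h = UNIV" "\<And>x. inv h (h x) = x"
    by (auto simp: bij_is_surj bij_is_inj)
  have "relation_of (conjugate h f) \<alpha> = (\<lambda>x. (\<alpha> x, \<alpha> (h (apply_bcontfun f (inv h x))))) ` range h"
    unfolding relation_of_eq_range apply_conjugate[OF assms] h(1) by simp
  also have "\<dots> = relation_of f (\<alpha> \<circ> h)"
    unfolding relation_of_eq_range image_image h(2) by simp
  finally show ?thesis .
qed

lemma Gamma_fun_conjugate_subset:
  assumes "compact (UNIV :: 'a::metric_space set)" "h \<in> homeos"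
  shows "Gamma_fun (conjugate h (f :: 'a \<Rightarrow>\<^sub>C 'a)) \<subseteq> Gamma_fun f"
proof -
  have h: "continuous_on UNIV h" "surj h" using homeos_imp_continuous homeos_imp_bij[THEN bij_is_surj] assms(2) by auto
  have "is_partition I (\<alpha> \<circ> h)" if "is_partition I \<alpha>" for I \<alpha>
  proof -
    have "range (\<alpha> \<circ> h) = I" "I \<in> index_sets"
      using that h(2) unfolding is_partition_def image_comp[symmetric] by simp_all
    moreover have "locally_constant (\<alpha> \<circ> h)"
      using locally_constant_continuous_compose[OF is_partition_imp_locally_constant[OF that] h(1)]
      by (simp add: o_def)
    ultimately show ?thesis using is_partitionI by metis
  qed
  then show ?thesis
    unfolding Gamma_fun_def relation_of_conjugate[OF assms] by blast
qed

lemma relation_of_in_Gamma_fun: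
  assumes "g \<in> Cs" "is_partition I \<alpha>"
  shows "relation_of g \<alpha> \<in> Gamma_fun g"
proof -
  have I: "I \<in> index_sets" "range \<alpha> = I" using assms(2) by (auto simp: is_partition_def)
  have "\<alpha> ` range (apply_bcontfun g) = I"
    using assms(1) I(2) by (simp add: Cs_def)
  then have "range (\<lambda>x. \<alpha> (apply_bcontfun g x)) = I" by (simp add: image_image)
  then have proj: "fst ` relation_of g \<alpha> = I" "snd ` relation_of g \<alpha> = I"
    using I(2) unfolding relation_of_eq_range image_image by simp_all
  then have "surjective_relation I (relation_of g \<alpha>)"
    using subset_fst_snd[of "relation_of g \<alpha>"] by (simp add: surjective_relation_def)
  then show ?thesis using assms(2) I(1) by (auto simp: Gamma_fun_def)
qed

text \<open>If \<open>g\<close> and \<open>f\<close> have the same relation, the partitions by itineraries of length two, that is by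
  the cells of a point and of its image, have the same labels. A homeomorphism that matches these
  itineraries conjugates \<open>f\<close> to a map that follows \<open>g\<close> from cell to cell.\<close>

lemma conjugate_close:
  fixes f g :: "'a::metric_space \<Rightarrow>\<^sub>C 'a"
  assumes X: "cantor_space (UNIV :: 'a set)"
    and "locally_constant \<alpha>" "locally_constant \<beta>"
    and rel: "relation_of g \<alpha> = relation_of f \<beta>"
    and fine: "\<And>x y. \<alpha> x = \<alpha> y \<Longrightarrow> dist x y < e"
  obtains h where "h \<in> homeos" "dist (conjugate h f) g \<le> e"
proof -
  let ?a = "\<lambda>x. (\<alpha> x, \<alpha> (apply_bcontfun g x))" and ?b = "\<lambda>x. (\<beta> x, \<beta> (apply_bcontfun f x))"
  have "locally_constant ?a"
    using assms(2) locally_constant_continuous_compose[OF assms(2) continuous_on_apply_bcontfun]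
    by (rule locally_constant_combine)
  moreover have "locally_constant ?b"
    using assms(3) locally_constant_continuous_compose[OF assms(3) continuous_on_apply_bcontfun]
    by (rule locally_constant_combine)
  moreover have "range ?b = range ?a" using rel unfolding relation_of_eq_range by simp
  ultimately obtain h k where hk: "homeomorphism UNIV UNIV h k" and eq: "\<And>x. ?a (h x) = ?b x"
    using homeomorphism_matching[OF X, of ?b ?a] by blast
  have h: "h \<in> homeos" using hk by (auto simp: homeos_def)
  then have "surj h" by (rule homeos_imp_bij[THEN bij_is_surj])
  have "dist (apply_bcontfun (conjugate h f) x) (apply_bcontfun g x) \<le> e" for x
  proof -
    define y where "y = inv h x"
    have x: "x = h y" using \<open>surj h\<close> by (simp add: y_def surj_f_inv_f)
    have "\<alpha> (h (apply_bcontfun f y)) = \<beta> (apply_bcontfun f y)" using eq by simp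
    also have "\<dots> = \<alpha> (apply_bcontfun g x)" using eq[of y] by (simp add: x)
    finally have "dist (h (apply_bcontfun f y)) (apply_bcontfun g x) < e" by (rule fine)
    then show ?thesis
      by (simp add: apply_conjugate[OF cantor_space_compact[OF X] h] y_def)
  qed
  then have "dist (conjugate h f) g \<le> e" by (rule dist_bound)
  with h that show ?thesis by blast
qed

text \<open>It suffices to look at one partition, namely one whose cells are smaller than the tolerance.\<close>

lemma approximate_by_conjugates:
  fixes g :: "'a::metric_space \<Rightarrow>\<^sub>C 'a"
  assumes X: "cantor_space (UNIV :: 'a set)"
    and "g \<in> Cs" "Gamma_fun g \<subseteq> Gamma_set K" "e > 0"
  obtains f h where "f \<in> K" "h \<in> homeos" "dist (conjugate h f) g < e"
proof -
  obtain \<gamma> :: "'a \<Rightarrow> nat"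
    where \<gamma>: "locally_constant \<gamma>" "\<And>x y. \<gamma> x = \<gamma> y \<Longrightarrow> dist x y < e/2"
    using fine_labelling[OF X, of "e/2"] \<open>e > 0\<close> by auto
  \<comment> \<open>Labels in an index set are lists of positive numbers, so \<open>\<gamma>\<close> is shifted and read as a list of
    length one.\<close>
  define \<alpha> where "\<alpha> x = [Suc (\<gamma> x)]" for x
  have \<alpha>: "locally_constant \<alpha>" unfolding \<alpha>_def using \<gamma>(1) by (rule locally_constant_compose)
  then have "finite (range \<alpha>)" by (rule finite_range_locally_constant[OF cantor_space_compact[OF X]])
  then have "range \<alpha> \<in> index_sets" by (auto simp: index_sets_def \<alpha>_def)
  then have "is_partition (range \<alpha>) \<alpha>" using \<alpha> by (rule is_partitionI)
  then have "relation_of g \<alpha> \<in> Gamma_set K"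
    using relation_of_in_Gamma_fun assms(2,3) by blast
  then obtain f I \<beta> where "f \<in> K" "is_partition I \<beta>" "relation_of g \<alpha> = relation_of f \<beta>"
    by (auto simp: Gamma_set_def Gamma_fun_def)
  moreover from this obtain h where "h \<in> homeos" "dist (conjugate h f) g \<le> e/2"
    using conjugate_close[OF X \<alpha> is_partition_imp_locally_constant, of I \<beta> g f "e/2"] \<gamma>(2)
    by (auto simp: \<alpha>_def)
  ultimately show ?thesis using that \<open>e > 0\<close> by force
qed

text \<open>Maps closer together than a Lebesgue number of a partition have the same relation under it.\<close>

lemma Gamma_fun_limit:
  fixes g :: "'a::metric_space \<Rightarrow>\<^sub>C 'a"
  assumes "compact (UNIV :: 'a set)" "g \<in> closure K"
  shows "Gamma_fun g \<subseteq> Gamma_set K"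
proof
  fix \<phi> assume "\<phi> \<in> Gamma_fun g"
  then obtain I \<alpha> where I: "I \<in> index_sets" "surjective_relation I \<phi>" "is_partition I \<alpha>"
      and \<phi>: "\<phi> = relation_of g \<alpha>"
    by (auto simp: Gamma_fun_def)
  obtain e where "e > 0" and e: "\<And>x y. dist x y < e \<Longrightarrow> \<alpha> x = \<alpha> y"
    using locally_constant_uniform[OF assms(1) is_partition_imp_locally_constant[OF I(3)]] by blast
  then obtain f where "f \<in> K" "dist f g < e"
    using assms(2) by (auto simp: closure_approachable)
  then have "\<alpha> (apply_bcontfun f x) = \<alpha> (apply_bcontfun g x)" for x
    by (intro e) (rule dist_fun_lt_imp_dist_val_lt)
  then have "\<phi> = relation_of f \<alpha>" by (simp add: \<phi> relation_of_def)
  then show "\<phi> \<in> Gamma_set K"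
    using I \<open>f \<in> K\<close> by (auto simp: Gamma_set_def Gamma_fun_def)
qed

theorem theorem3p14:
  assumes "cantor_space (UNIV :: 'a::metric_space set)"
  shows "(\<forall>K K0 :: ('a \<Rightarrow>\<^sub>C 'a) set.
            K \<subseteq> Cs \<and> K0 \<subseteq> Cs \<and> conj_invariant K \<and> conj_invariant K0 \<and>
            closedin (top_of_set Cs) K \<longrightarrow>
            (K0 \<subseteq> K \<longleftrightarrow> Gamma_set K0 \<subseteq> Gamma_set K)) \<and>
         (\<forall>f :: 'a \<Rightarrow>\<^sub>C 'a. f \<in> Cs \<longrightarrow>
            top_of_set Cs closure_of conj_class f = {g \<in> Cs. Gamma_fun g \<subseteq> Gamma_fun f})"
proof (intro conjI allI impI)
  fix K K0 :: "('a \<Rightarrow>\<^sub>C 'a) set"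
  assume *: "K \<subseteq> Cs \<and> K0 \<subseteq> Cs \<and> conj_invariant K \<and> conj_invariant K0 \<and>
    closedin (top_of_set Cs) K"
  show "K0 \<subseteq> K \<longleftrightarrow> Gamma_set K0 \<subseteq> Gamma_set K"
  proof
    assume "K0 \<subseteq> K"
    then show "Gamma_set K0 \<subseteq> Gamma_set K" by (auto simp: Gamma_set_def)
  next
    assume sub: "Gamma_set K0 \<subseteq> Gamma_set K"
    show "K0 \<subseteq> K"
    proof
      fix g assume "g \<in> K0"
      then have "g \<in> Cs" "Gamma_fun g \<subseteq> Gamma_set K" using * sub by (auto simp: Gamma_set_def)
      then have "\<exists>f\<in>K. dist f g < e" if "e > 0" for e
        using approximate_by_conjugates[OF assms _ _ that, of g K] *
        unfolding conj_invariant_def by metis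
      then have "g \<in> closure K" by (simp add: closure_approachable)
      moreover obtain C where "closed C" "K = Cs \<inter> C" using * by (auto simp: closedin_closed)
      ultimately show "g \<in> K" using \<open>g \<in> Cs\<close> by (metis IntI closure_minimal inf_le2 subsetD)
    qed
  qed
next
  fix f :: "'a \<Rightarrow>\<^sub>C 'a" assume f: "f \<in> Cs"
  note cpt = cantor_space_compact[OF assms]
  have "Gamma_fun g \<subseteq> Gamma_fun f" if "g \<in> closure (conj_class f)" for g
    using Gamma_fun_limit[OF cpt that] Gamma_fun_conjugate_subset[OF cpt]
    by (fastforce simp: Gamma_set_def conj_class_def)
  moreover have "g \<in> closure (conj_class f)" if g: "g \<in> Cs" "Gamma_fun g \<subseteq> Gamma_fun f" for g
    unfolding closure_approachable
  proof (intro allI impI)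
    fix e :: real assume "e > 0"
    have "Gamma_fun g \<subseteq> Gamma_set {f}" using g(2) by (simp add: Gamma_set_def)
    from approximate_by_conjugates[OF assms g(1) this \<open>e > 0\<close>]
    obtain h where "h \<in> homeos" "dist (conjugate h f) g < e" by blast
    then show "\<exists>q\<in>conj_class f. dist q g < e" by (auto simp: conj_class_def)
  qed
  moreover have "top_of_set Cs closure_of conj_class f = Cs \<inter> closure (conj_class f)"
    using conj_class_subset_Cs[OF cpt f]
    by (simp add: closure_of_subtopology Int_absorb1)
  ultimately show "top_of_set Cs closure_of conj_class f = {g \<in> Cs. Gamma_fun g \<subseteq> Gamma_fun f}"
    by blast
qed

end
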